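(* There exists a finite simple connected undirected graph on $8$ vertices containing two vertices that are cospectral but not similar, and no finite simple connected undirected graph on fewer than $8$ vertices contains two vertices that are cospectral but not similar.
   Context: For a finite simple graph with adjacency matrix $A$, let $\phi_1,\dots,\phi_n$ be a real orthonormal eigenbasis of $A$ with $A\phi_j=\lambda_j\phi_j$. Two vertices $a,b$ are cospectral if $\sum_{j:\lambda_j=\lambda}|\phi_j(a)|^2=\sum_{j:\lambda_j=\lambda}|\phi_j(b)|^2$ for every eigenvalue $\lambda$ (equivalently, $(A^k)_{a,a}=(A^k)_{b,b}$ for all $k\ge 0$). Two vertices $a,b$ are similar if some graph automorphism maps $a$ to $b$. *)

theory Defs
  imports Complex_Main "Graph_Theory.Graph_Theory" "Jordan_Normal_Form.Determinant"
begin

text \<open>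
  A finite simple undirected graph is a \<^locale>\<open>pair_graph\<close>: a finite vertex set together with
  a symmetric irreflexive set of ordered pairs of vertices, each edge occurring in both
  orientations. Vectors and matrices are indexed by the vertices themselves: a vector is a function
  of which only the values on \<open>pverts G\<close> matter.
\<close>

definition adj_matrix :: "'a pair_pre_digraph \<Rightarrow> 'a \<Rightarrow> 'a \<Rightarrow> real" where
  "adj_matrix G u v = (if (u, v) \<in> parcs G then 1 else 0)"

text \<open>
  As many orthonormal vectors as there are vertices automatically form a basis; see
  \<open>orthonormal_eigenbasis_expand\<close> below.
\<close>

definition orthonormal_eigenbasis ::
  "'a pair_pre_digraph \<Rightarrow> (nat \<Rightarrow> 'a \<Rightarrow> real) \<Rightarrow> (nat \<Rightarrow> real) \<Rightarrow> bool" where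
  "orthonormal_eigenbasis G \<phi> \<theta> \<longleftrightarrow>
     (\<forall>i < card (pverts G). \<forall>j < card (pverts G).
        (\<Sum>v\<in>pverts G. \<phi> i v * \<phi> j v) = (if i = j then 1 else 0)) \<and>
     (\<forall>j < card (pverts G). \<forall>u\<in>pverts G.
        (\<Sum>v\<in>pverts G. adj_matrix G u v * \<phi> j v) = \<theta> j * \<phi> j u)"

definition eigenspace_weight ::
  "'a pair_pre_digraph \<Rightarrow> (nat \<Rightarrow> 'a \<Rightarrow> real) \<Rightarrow> (nat \<Rightarrow> real) \<Rightarrow> real \<Rightarrow> 'a \<Rightarrow> real" where
  "eigenspace_weight G \<phi> \<theta> \<mu> a = (\<Sum>j | j < card (pverts G) \<and> \<theta> j = \<mu>. \<bar>\<phi> j a\<bar>\<^sup>2)"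

text \<open>
  The choice of eigenbasis is immaterial; see \<open>cospectral_iff\<close> below. The eigenvalues are exactly
  the \<open>\<theta> j\<close> with \<open>j < card (pverts G)\<close>.
\<close>

definition cospectral :: "'a pair_pre_digraph \<Rightarrow> 'a \<Rightarrow> 'a \<Rightarrow> bool" where
  "cospectral G a b \<longleftrightarrow>
     (\<exists>\<phi> \<theta>. orthonormal_eigenbasis G \<phi> \<theta> \<and>
        (\<forall>\<mu> \<in> \<theta> ` {..<card (pverts G)}.
           eigenspace_weight G \<phi> \<theta> \<mu> a = eigenspace_weight G \<phi> \<theta> \<mu> b))"

definition graph_automorphism :: "'a pair_pre_digraph \<Rightarrow> ('a \<Rightarrow> 'a) \<Rightarrow> bool" where
  "graph_automorphism G f \<longleftrightarrow>
     bij_betw f (pverts G) (pverts G) \<and>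
     (\<forall>u\<in>pverts G. \<forall>v\<in>pverts G. (f u, f v) \<in> parcs G \<longleftrightarrow> (u, v) \<in> parcs G)"

definition similar_vertices :: "'a pair_pre_digraph \<Rightarrow> 'a \<Rightarrow> 'a \<Rightarrow> bool" where
  "similar_vertices G a b \<longleftrightarrow> (\<exists>f. graph_automorphism G f \<and> f a = b)"


lemma orthonormal_eigenbasis_expand:
  assumes fin: "finite (pverts G)" and B: "orthonormal_eigenbasis G \<phi> \<theta>" and u: "u \<in> pverts G"
  shows "f u = (\<Sum>i<card (pverts G). (\<Sum>v\<in>pverts G. f v * \<phi> i v) * \<phi> i u)"
proof -
  define n where "n = card (pverts G)"
  obtain e where e: "bij_betw e {0..<n} (pverts G)"
    using ex_bij_betw_nat_finite[OF fin] unfolding n_def by blast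
  define U where "U = mat n n (\<lambda>(i, k). \<phi> i (e k))"
  have U: "U \<in> carrier_mat n n" unfolding U_def by simp
  have "U * transpose_mat U = 1\<^sub>m n"
  proof (rule eq_matI)
    fix i j assume "i < dim_row (1\<^sub>m n :: real mat)" "j < dim_col (1\<^sub>m n :: real mat)"
    then have ij: "i < n" "j < n" by auto
    have "(U * transpose_mat U) $$ (i, j) = (\<Sum>k\<in>{0..<n}. \<phi> i (e k) * \<phi> j (e k))"
      using ij by (simp add: U_def scalar_prod_def)
    also have "\<dots> = (\<Sum>v\<in>pverts G. \<phi> i v * \<phi> j v)"
      by (rule sum.reindex_bij_betw[OF e])
    also have "\<dots> = 1\<^sub>m n $$ (i, j)"
      using B ij unfolding orthonormal_eigenbasis_def n_def by auto
    finally show "(U * transpose_mat U) $$ (i, j) = 1\<^sub>m n $$ (i, j)" .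
  qed (auto simp: U_def)
  then have UU: "transpose_mat U * U = 1\<^sub>m n"
    using mat_mult_left_right_inverse[OF U, of "transpose_mat U"] U by simp
  have compl: "(\<Sum>i<n. \<phi> i v * \<phi> i u) = (if v = u then 1 else 0)" if v: "v \<in> pverts G" for v
  proof -
    obtain k l where kl: "k < n" "l < n" "v = e k" "u = e l"
      using e u v unfolding bij_betw_def by (metis atLeastLessThan_iff imageE)
    have "(\<Sum>i<n. \<phi> i v * \<phi> i u) = (transpose_mat U * U) $$ (k, l)"
      using kl by (simp add: U_def scalar_prod_def atLeast0LessThan)
    also have "\<dots> = (if k = l then 1 else 0)" using UU kl by simp
    also have "(k = l) = (v = u)"
      using kl e unfolding bij_betw_def by (auto dest: inj_onD)
    finally show ?thesis .
  qed
  have "(\<Sum>i<n. (\<Sum>v\<in>pverts G. f v * \<phi> i v) * \<phi> i u) = (\<Sum>i<n. \<Sum>v\<in>pverts G. f v * (\<phi> i v * \<phi> i u))"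
    by (simp add: sum_distrib_right mult.assoc)
  also have "\<dots> = (\<Sum>v\<in>pverts G. \<Sum>i<n. f v * (\<phi> i v * \<phi> i u))"
    by (rule sum.swap)
  also have "\<dots> = (\<Sum>v\<in>pverts G. f v * (if v = u then 1 else 0))"
    by (intro sum.cong refl) (simp add: sum_distrib_left[symmetric] compl)
  also have "\<dots> = f u"
    using fin u by (simp add: if_distrib[of "(*) _"] sum.delta cong: if_cong)
  finally show ?thesis by (simp add: n_def)
qed

lemma eigenspace_weight_unique:
  assumes G: "pair_graph G"
    and B: "orthonormal_eigenbasis G \<phi> \<theta>" and C: "orthonormal_eigenbasis G \<psi> \<eta>"
    and a: "a \<in> pverts G"
  shows "eigenspace_weight G \<phi> \<theta> \<mu> a = eigenspace_weight G \<psi> \<eta> \<mu> a"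
proof -
  interpret pair_graph G by fact
  let ?V = "pverts G" let ?n = "card ?V"
  have fin: "finite ?V" by simp
  have sym: "adj_matrix G u v = adj_matrix G v u" for u v
    using sym_arcs unfolding adj_matrix_def symmetric_def by (auto dest: symD)
  define c where "c i j = (\<Sum>v\<in>?V. \<phi> i v * \<psi> j v)" for i j
  have c0: "c i j = 0" if "i < ?n" "j < ?n" "\<theta> i \<noteq> \<eta> j" for i j
  proof -
    have "\<theta> i * c i j = (\<Sum>v\<in>?V. (\<Sum>w\<in>?V. adj_matrix G v w * \<phi> i w) * \<psi> j v)"
      using B that unfolding c_def orthonormal_eigenbasis_def
      by (simp add: sum_distrib_left mult.assoc)
    also have "\<dots> = (\<Sum>v\<in>?V. \<Sum>w\<in>?V. adj_matrix G v w * \<phi> i w * \<psi> j v)"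
      by (simp add: sum_distrib_right)
    also have "\<dots> = (\<Sum>w\<in>?V. \<Sum>v\<in>?V. adj_matrix G v w * \<phi> i w * \<psi> j v)"
      by (rule sum.swap)
    also have "\<dots> = (\<Sum>w\<in>?V. \<phi> i w * (\<Sum>v\<in>?V. adj_matrix G w v * \<psi> j v))"
      unfolding sum_distrib_left
    proof (intro sum.cong refl)
      fix w v
      show "adj_matrix G v w * \<phi> i w * \<psi> j v = \<phi> i w * (adj_matrix G w v * \<psi> j v)"
        using sym[of v w] by simp
    qed
    also have "\<dots> = (\<Sum>w\<in>?V. \<phi> i w * (\<eta> j * \<psi> j w))"
      using C that unfolding orthonormal_eigenbasis_def by (intro sum.cong refl) simp
    also have "\<dots> = \<eta> j * c i j"
      unfolding c_def by (simp add: sum_distrib_left mult_ac)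
    finally show ?thesis using that(3) by simp
  qed
  let ?I = "{i. i < ?n \<and> \<theta> i = \<mu>}" and ?J = "{j. j < ?n \<and> \<eta> j = \<mu>}"
  have phi: "\<phi> i a = (\<Sum>j\<in>?J. c i j * \<psi> j a)" if "i \<in> ?I" for i
  proof -
    have "\<phi> i a = (\<Sum>j<?n. c i j * \<psi> j a)"
      unfolding c_def by (rule orthonormal_eigenbasis_expand[OF fin C a])
    also have "\<dots> = (\<Sum>j\<in>?J. c i j * \<psi> j a)"
    proof (rule sum.mono_neutral_right)
      show "\<forall>j\<in>{..<?n} - ?J. c i j * \<psi> j a = 0"
      proof
        fix j assume "j \<in> {..<?n} - ?J"
        with that have "i < ?n" "j < ?n" "\<theta> i \<noteq> \<eta> j" by auto
        then have "c i j = 0" by (rule c0)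
        then show "c i j * \<psi> j a = 0" by simp
      qed
    qed auto
    finally show ?thesis .
  qed
  have psi: "\<psi> j a = (\<Sum>i\<in>?I. c i j * \<phi> i a)" if "j \<in> ?J" for j
  proof -
    have "\<psi> j a = (\<Sum>i<?n. (\<Sum>v\<in>?V. \<psi> j v * \<phi> i v) * \<phi> i a)"
      by (rule orthonormal_eigenbasis_expand[OF fin B a])
    also have "\<dots> = (\<Sum>i<?n. c i j * \<phi> i a)"
      unfolding c_def by (simp add: mult.commute)
    also have "\<dots> = (\<Sum>i\<in>?I. c i j * \<phi> i a)"
    proof (rule sum.mono_neutral_right)
      show "\<forall>i\<in>{..<?n} - ?I. c i j * \<phi> i a = 0"
      proof
        fix i assume "i \<in> {..<?n} - ?I"
        with that have "i < ?n" "j < ?n" "\<theta> i \<noteq> \<eta> j" by auto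
        then have "c i j = 0" by (rule c0)
        then show "c i j * \<phi> i a = 0" by simp
      qed
    qed auto
    finally show ?thesis .
  qed
  have "eigenspace_weight G \<phi> \<theta> \<mu> a = (\<Sum>i\<in>?I. \<phi> i a * (\<Sum>j\<in>?J. c i j * \<psi> j a))"
    unfolding eigenspace_weight_def power2_abs unfolding power2_eq_square
    by (intro sum.cong refl) (simp only: phi[symmetric])
  also have "\<dots> = (\<Sum>i\<in>?I. \<Sum>j\<in>?J. \<psi> j a * (c i j * \<phi> i a))"
    by (simp add: sum_distrib_left mult_ac)
  also have "\<dots> = (\<Sum>j\<in>?J. \<Sum>i\<in>?I. \<psi> j a * (c i j * \<phi> i a))"
    by (rule sum.swap)
  also have "\<dots> = (\<Sum>j\<in>?J. \<psi> j a * (\<Sum>i\<in>?I. c i j * \<phi> i a))"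
    by (simp add: sum_distrib_left)
  also have "\<dots> = eigenspace_weight G \<psi> \<eta> \<mu> a"
    unfolding eigenspace_weight_def power2_abs unfolding power2_eq_square
    by (intro sum.cong refl) (simp only: psi[symmetric])
  finally show ?thesis .
qed

lemma eigenspace_weight_non_eigenvalue:
  "\<mu> \<notin> \<theta> ` {..<card (pverts G)} \<Longrightarrow> eigenspace_weight G \<phi> \<theta> \<mu> a = 0"
  unfolding eigenspace_weight_def by (rule sum.neutral) auto

lemma cospectral_iff:
  assumes "pair_graph G" "orthonormal_eigenbasis G \<psi> \<eta>" "a \<in> pverts G" "b \<in> pverts G"
  shows "cospectral G a b \<longleftrightarrow>
    (\<forall>\<mu>. eigenspace_weight G \<psi> \<eta> \<mu> a = eigenspace_weight G \<psi> \<eta> \<mu> b)"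
proof
  assume "cospectral G a b"
  then obtain \<phi> \<theta> where B: "orthonormal_eigenbasis G \<phi> \<theta>"
    and eq: "\<forall>\<mu> \<in> \<theta> ` {..<card (pverts G)}.
           eigenspace_weight G \<phi> \<theta> \<mu> a = eigenspace_weight G \<phi> \<theta> \<mu> b"
    unfolding cospectral_def by blast
  have "eigenspace_weight G \<phi> \<theta> \<mu> a = eigenspace_weight G \<phi> \<theta> \<mu> b" for \<mu>
    by (cases "\<mu> \<in> \<theta> ` {..<card (pverts G)}") (use eq in blast, simp add: eigenspace_weight_non_eigenvalue)
  then show "\<forall>\<mu>. eigenspace_weight G \<psi> \<eta> \<mu> a = eigenspace_weight G \<psi> \<eta> \<mu> b"
    using eigenspace_weight_unique[OF assms(1) B assms(2)] assms(3,4) by simp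
next
  assume "\<forall>\<mu>. eigenspace_weight G \<psi> \<eta> \<mu> a = eigenspace_weight G \<psi> \<eta> \<mu> b"
  with assms(2) show "cospectral G a b" unfolding cospectral_def by blast
qed

end

theory Submission
  imports Defs
begin

text \<open>
  The witness on 8 vertices has an integral spectrum, so an eigenbasis can be written down explicitly.

  For at most 7 vertices, put \<open>s = e\<^sub>a - e\<^sub>b\<close> and \<open>t = e\<^sub>a + e\<^sub>b\<close>. Cospectrality says that every
  eigenprojection of \<open>s\<close> is orthogonal to that of \<open>t\<close>. This survives the passage to the adjacency
  operator \<open>H\<close> of the graph with \<open>a\<close> and \<open>b\<close> removed: if \<open>u\<close> and \<open>w\<close> are the restrictions of
  \<open>A s\<close> and \<open>A t\<close> to the other vertices, then \<open>H\<^sup>i u\<close> is orthogonal to \<open>H\<^sup>j w\<close> for all \<open>i\<close> and \<open>j\<close>.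
  The case \<open>i = j = 0\<close> says that \<open>a\<close> and \<open>b\<close> have equally many private neighbours, hence at most two
  each. If there are none, the transposition of \<open>a\<close> and \<open>b\<close> is an automorphism. Otherwise the
  relations with \<open>i + j \<le> 4\<close> leave finitely many adjacency patterns on the five other vertices,
  and each of them has an involutive automorphism exchanging \<open>a\<close> and \<open>b\<close>.
\<close>

section \<open>Cospectrality as orthogonality relations on the remaining vertices\<close>

text \<open>The adjacency operator of the subgraph induced on \<open>R\<close>. The value type stays
  generic because the spectral argument runs over the reals and the case analysis over the
  integers.\<close>

definition hop :: "('a \<Rightarrow> 'a \<Rightarrow> bool) \<Rightarrow> 'a set \<Rightarrow> ('a \<Rightarrow> 'b) \<Rightarrow> 'a \<Rightarrow> 'b :: comm_ring_1" where
  "hop E R f v = (\<Sum>x\<in>R. of_bool (E v x) * f x)"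

definition balanced :: "('a \<Rightarrow> 'a \<Rightarrow> bool) \<Rightarrow> 'a set \<Rightarrow> 'a \<Rightarrow> 'a \<Rightarrow> bool" where
  "balanced E R a b \<longleftrightarrow> (\<forall>i j.
     (\<Sum>v\<in>R. (hop E R ^^ i) (\<lambda>v. of_bool (E v a) - of_bool (E v b)) v *
             (hop E R ^^ j) (\<lambda>v. of_bool (E v a) + of_bool (E v b)) v) = (0 :: int))"

lemma of_int_hop_funpow: "of_int ((hop E R ^^ i) f v) = (hop E R ^^ i) (\<lambda>x. of_int (f x)) v"
proof (induction i arbitrary: v)
  case (Suc i)
  show ?case by (simp add: hop_def[of E R "(hop E R ^^ i) _"] Suc)
qed simp

text \<open>Orthogonality within every eigenspace is preserved by \<open>A\<close> and by linear
  combinations. Truncating \<open>A f\<close> to \<open>R\<close> subtracts only a multiple of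
  \<open>s\<close> or of \<open>t\<close>, so the whole iteration stays inside the class of pairs
  that are orthogonal in this sense.\<close>

lemma cospectral_imp_balanced:
  assumes G: "pair_graph G" and a: "a \<in> pverts G" and b: "b \<in> pverts G" and ab: "a \<noteq> b"
    and cosp: "cospectral G a b"
  shows "balanced (\<lambda>u v. (u, v) \<in> parcs G) (pverts G - {a, b}) a b"
proof -
  interpret pair_graph G by fact
  let ?n = "card (pverts G)"
  define V where "V = pverts G"
  define R where "R = V - {a, b}"
  define E where "E u v \<longleftrightarrow> (u, v) \<in> parcs G" for u v
  have finV: "finite V" and aV: "a \<in> V" and bV: "b \<in> V" and finR: "finite R" and aR: "a \<notin> R" and bR: "b \<notin> R"
    using a b by (auto simp: V_def R_def)
  have Vins: "V = insert a (insert b R)" using aV bV by (auto simp: R_def)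
  have symE: "E u v \<longleftrightarrow> E v u" for u v
    using sym_arcs unfolding E_def symmetric_def by (auto dest: symD)
  obtain \<phi> \<theta> where B: "orthonormal_eigenbasis G \<phi> \<theta>"
    using cosp unfolding cospectral_def by blast
  have wt: "eigenspace_weight G \<phi> \<theta> \<mu> a = eigenspace_weight G \<phi> \<theta> \<mu> b" for \<mu>
    using cosp cospectral_iff[OF G B a b] by blast
  define ip where "ip f g = (\<Sum>v\<in>V. f v * g v)" for f g :: "'a \<Rightarrow> real"
  define A where "A = (hop E V :: ('a \<Rightarrow> real) \<Rightarrow> 'a \<Rightarrow> real)"
  \<comment> \<open>The summand for \<mu> is the inner product of the projections of
    \<open>f\<close> and \<open>g\<close> onto the eigenspace of \<mu>.\<close>
  define orth where "orth f g \<longleftrightarrow> (\<forall>\<mu>. (\<Sum>j | j < ?n \<and> \<theta> j = \<mu>. ip f (\<phi> j) * ip g (\<phi> j)) = 0)" for f g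
  define s where "s v = (of_bool (v = a) - of_bool (v = b) :: real)" for v
  define t where "t v = (of_bool (v = a) + of_bool (v = b) :: real)" for v
  \<comment> \<open>On functions that vanish at \<open>a\<close> and \<open>b\<close> this is the
    adjacency operator of the smaller graph, extended by zero. Its values at \<open>s\<close> and
    \<open>t\<close> are the restricted vectors \<open>u\<close> and \<open>w\<close> of the
    overview.\<close>
  define H where "H f v = (if v \<in> R then A f v else 0)" for f v
  have Aab: "A f v = of_bool (E v a) * f a + of_bool (E v b) * f b + hop E R f v" for f v
    unfolding A_def hop_def Vins using ab aR bR finR by simp
  have ip_A: "ip (A f) (\<phi> j) = \<theta> j * ip f (\<phi> j)" if "j < ?n" for f j
  proof -
    have "ip (A f) (\<phi> j) = (\<Sum>v\<in>V. \<Sum>x\<in>V. of_bool (E v x) * f x * \<phi> j v)"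
      by (simp add: ip_def A_def hop_def sum_distrib_right)
    also have "\<dots> = (\<Sum>x\<in>V. \<Sum>v\<in>V. of_bool (E v x) * f x * \<phi> j v)"
      by (rule sum.swap)
    also have "\<dots> = (\<Sum>x\<in>V. f x * (\<Sum>v\<in>V. adj_matrix G x v * \<phi> j v))"
      unfolding sum_distrib_left
      by (intro sum.cong refl) (auto simp: adj_matrix_def symE E_def[symmetric])
    also have "\<dots> = (\<Sum>x\<in>V. f x * (\<theta> j * \<phi> j x))"
      using B that unfolding orthonormal_eigenbasis_def V_def by (intro sum.cong refl) simp
    also have "\<dots> = \<theta> j * ip f (\<phi> j)"
      by (simp add: ip_def sum_distrib_left mult_ac)
    finally show ?thesis .
  qed
  \<comment> \<open>Expanding \<open>g\<close> in the eigenbasis and grouping the terms by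
    eigenvalue writes the inner product as a sum of vanishing eigenspace contributions.\<close>
  have orth_ip: "ip f g = 0" if "orth f g" for f g
  proof -
    have "ip f g = (\<Sum>v\<in>V. f v * (\<Sum>j<?n. ip g (\<phi> j) * \<phi> j v))"
      unfolding ip_def[of f] V_def
    proof (intro sum.cong refl arg_cong2[where f = "(*)"])
      fix v assume "v \<in> pverts G"
      then show "g v = (\<Sum>j<?n. ip g (\<phi> j) * \<phi> j v)"
        using orthonormal_eigenbasis_expand[OF _ B, of v g] by (simp add: ip_def V_def)
    qed
    also have "\<dots> = (\<Sum>v\<in>V. \<Sum>j<?n. f v * \<phi> j v * ip g (\<phi> j))"
      by (simp add: sum_distrib_left mult_ac)
    also have "\<dots> = (\<Sum>j<?n. \<Sum>v\<in>V. f v * \<phi> j v * ip g (\<phi> j))"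
      by (rule sum.swap)
    also have "\<dots> = (\<Sum>j<?n. ip f (\<phi> j) * ip g (\<phi> j))"
      by (simp add: ip_def sum_distrib_right)
    also have "\<dots> = (\<Sum>\<mu>\<in>\<theta> ` {..<?n}. \<Sum>j | j \<in> {..<?n} \<and> \<theta> j = \<mu>. ip f (\<phi> j) * ip g (\<phi> j))"
      by (rule sum.image_gen) simp
    also have "\<dots> = 0"
      using that by (intro sum.neutral) (simp add: orth_def)
    finally show ?thesis .
  qed
  have ip_delta: "ip s g = g a - g b" "ip t g = g a + g b" for g
    unfolding ip_def s_def t_def Vins using ab aR bR finR by (auto intro!: sum.neutral)
  have ip_commute: "ip f g = ip g f" for f g by (simp add: ip_def mult.commute)
  \<comment> \<open>The product of \<open>\<phi> j a - \<phi> j b\<close> and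
    \<open>\<phi> j a + \<phi> j b\<close> is a difference of squares, so each sum is a difference
    of two eigenspace weights.\<close>
  have orth_st: "orth s t"
    unfolding orth_def ip_delta
  proof
    fix \<mu>
    have "(\<Sum>j | j < ?n \<and> \<theta> j = \<mu>. (\<phi> j a - \<phi> j b) * (\<phi> j a + \<phi> j b)) = eigenspace_weight G \<phi> \<theta> \<mu> a - eigenspace_weight G \<phi> \<theta> \<mu> b"
      unfolding eigenspace_weight_def sum_subtractf[symmetric]
      by (intro sum.cong refl) (simp add: power2_eq_square algebra_simps)
    with wt[of \<mu>] show "(\<Sum>j | j < ?n \<and> \<theta> j = \<mu>. (\<phi> j a - \<phi> j b) * (\<phi> j a + \<phi> j b)) = 0" by simp
  qed
  \<comment> \<open>Within one eigenspace \<open>\<theta> j\<close> is the constant \<mu>. The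
    hypothesis on \<open>h\<close> expresses \<open>h = A f - c * k\<close> through
    coefficients.\<close>
  have orth_lin: "orth h g" if "orth f g" "orth k g"
      "\<And>j. j < ?n \<Longrightarrow> ip h (\<phi> j) = \<theta> j * ip f (\<phi> j) - c * ip k (\<phi> j)" for f g h k c
    unfolding orth_def
  proof
    fix \<mu>
    have "(\<Sum>j | j < ?n \<and> \<theta> j = \<mu>. ip h (\<phi> j) * ip g (\<phi> j)) =
      (\<Sum>j | j < ?n \<and> \<theta> j = \<mu>. \<mu> * (ip f (\<phi> j) * ip g (\<phi> j)) - c * (ip k (\<phi> j) * ip g (\<phi> j)))"
      by (intro sum.cong refl) (auto simp: that(3) algebra_simps)
    also have "\<dots> = 0"
      using that(1,2) by (simp add: sum_subtractf sum_distrib_left[symmetric] orth_def)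
    finally show "(\<Sum>j | j < ?n \<and> \<theta> j = \<mu>. ip h (\<phi> j) * ip g (\<phi> j)) = 0" .
  qed
  have orth_commute: "orth f g \<longleftrightarrow> orth g f" for f g
    by (simp add: orth_def mult.commute)
  have orth_A: "orth (A f) g" if "orth f g" for f g
    by (rule orth_lin[OF that that, of "A f" 0]) (simp add: ip_A)
  \<comment> \<open>Since \<open>A f\<close> is orthogonal to \<open>t\<close>, its values at
    \<open>a\<close> and \<open>b\<close> are opposite, and deleting them subtracts
    \<open>A f a\<close> times \<open>s\<close>. For \<open>H_right\<close> orthogonality to
    \<open>s\<close> makes the two values equal, and a multiple of \<open>t\<close> is
    subtracted.\<close>
  have H_left: "ip (H f) (\<phi> j) = \<theta> j * ip f (\<phi> j) - A f a * ip s (\<phi> j)" if "orth f t" "j < ?n" for f j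
  proof -
    have "A f b = - A f a"
      using orth_ip[OF orth_A[OF that(1)]] ip_delta(2)[of "A f"] ip_commute[of t "A f"] by linarith
    then have Hv: "H f v = A f v - A f a * s v" if "v \<in> V" for v
      using that ab aR bR by (auto simp: H_def s_def Vins)
    have "ip (H f) (\<phi> j) = (\<Sum>v\<in>V. A f v * \<phi> j v - A f a * (s v * \<phi> j v))"
      unfolding ip_def by (intro sum.cong refl) (simp add: Hv left_diff_distrib)
    also have "\<dots> = ip (A f) (\<phi> j) - A f a * ip s (\<phi> j)"
      by (simp add: ip_def sum_subtractf sum_distrib_left)
    finally show ?thesis using ip_A[OF that(2)] by simp
  qed
  have H_right: "ip (H g) (\<phi> j) = \<theta> j * ip g (\<phi> j) - A g a * ip t (\<phi> j)" if "orth s g" "j < ?n" for g j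
  proof -
    have "A g b = A g a"
      using orth_ip[of s "A g"] orth_A[of g s] that(1) ip_delta(1)[of "A g"] by (simp add: orth_commute)
    then have Hv: "H g v = A g v - A g a * t v" if "v \<in> V" for v
      using that ab aR bR by (auto simp: H_def t_def Vins)
    have "ip (H g) (\<phi> j) = (\<Sum>v\<in>V. A g v * \<phi> j v - A g a * (t v * \<phi> j v))"
      unfolding ip_def by (intro sum.cong refl) (simp add: Hv left_diff_distrib)
    also have "\<dots> = ip (A g) (\<phi> j) - A g a * ip t (\<phi> j)"
      by (simp add: ip_def sum_subtractf sum_distrib_left)
    finally show ?thesis using ip_A[OF that(2)] by simp
  qed
  \<comment> \<open>The one-sided families come first: \<open>left\<close> is the side condition for
    \<open>H_left\<close>, and \<open>right\<close> is both the base case and the correction term in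
    the induction for the two-sided family.\<close>
  have left: "orth ((H ^^ i) s) t" for i
    by (induction i) (auto intro: orth_st orth_lin[OF _ orth_st] H_left)
  have right: "orth s ((H ^^ j) t)" for j
  proof (induction j)
    case (Suc j)
    have "orth (H ((H ^^ j) t)) s"
      by (rule orth_lin[OF _ _ H_right[OF Suc]]) (use Suc orth_st in \<open>simp_all add: orth_commute\<close>)
    then show ?case by (simp add: orth_commute)
  qed (simp add: orth_st)
  have "orth ((H ^^ i) s) ((H ^^ j) t)" for i j
  proof (induction i)
    case (Suc i)
    then show ?case
      using orth_lin[OF _ right H_left[OF left]] by simp
  qed (simp add: right)
  then have main: "ip ((H ^^ i) s) ((H ^^ j) t) = 0" for i j by (rule orth_ip)
  have hop_cong: "hop E R f v = hop E R g v" if "\<And>x. x \<in> R \<Longrightarrow> f x = g x" for f g v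
    using that by (simp add: hop_def)
  \<comment> \<open>After one application of \<open>H\<close> the function vanishes at
    \<open>a\<close> and \<open>b\<close>, and from then on \<open>H\<close> acts on
    \<open>R\<close> as \<open>hop E R\<close>. Hence the exponent shifts by one.\<close>
  have iter: "(H ^^ Suc i) f v = (hop E R ^^ i) g v"
    if v: "v \<in> R" and g: "\<And>v. v \<in> R \<Longrightarrow> A f v = g v" for i f g v
    using v
  proof (induction i arbitrary: v)
    case (Suc i)
    have "(H ^^ Suc (Suc i)) f v = A ((H ^^ Suc i) f) v"
      using Suc.prems by (simp add: H_def)
    also have "\<dots> = hop E R ((H ^^ Suc i) f) v"
      using aR bR by (simp add: Aab H_def)
    also have "\<dots> = hop E R ((hop E R ^^ i) g) v"
      by (rule hop_cong) (rule Suc.IH)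
    finally show ?case by simp
  qed (simp add: H_def g)
  have "(\<Sum>v\<in>R. (hop E R ^^ i) (\<lambda>v. of_bool (E v a) - of_bool (E v b)) v *
             (hop E R ^^ j) (\<lambda>v. of_bool (E v a) + of_bool (E v b)) v) = (0 :: real)" for i j
  proof -
    have s0: "hop E R s v = 0" "hop E R t v = 0" for v
      using aR bR by (auto simp: hop_def s_def t_def intro!: sum.neutral)
    have As: "A s v = of_bool (E v a) - of_bool (E v b)" and At: "A t v = of_bool (E v a) + of_bool (E v b)" for v
      using ab by (simp_all add: Aab s0) (simp_all add: s_def t_def)
    have "0 = ip ((H ^^ Suc i) s) ((H ^^ Suc j) t)" by (rule main[symmetric])
    also have "\<dots> = (\<Sum>v\<in>R. (H ^^ Suc i) s v * (H ^^ Suc j) t v)"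
      unfolding ip_def by (rule sum.mono_neutral_right[OF finV]) (auto simp: R_def H_def)
    also have "\<dots> = (\<Sum>v\<in>R. (hop E R ^^ i) (\<lambda>v. of_bool (E v a) - of_bool (E v b)) v *
             (hop E R ^^ j) (\<lambda>v. of_bool (E v a) + of_bool (E v b)) v)"
      by (intro sum.cong refl arg_cong2[where f = "(*)"] iter As At)
    finally show ?thesis by simp
  qed
  \<comment> \<open>The vectors have integer entries, so the real relations descend to integer ones,
    which can be evaluated.\<close>
  then have "real_of_int (\<Sum>v\<in>R. (hop E R ^^ i) (\<lambda>v. of_bool (E v a) - of_bool (E v b)) v *
             (hop E R ^^ j) (\<lambda>v. of_bool (E v a) + of_bool (E v b)) v) = 0" for i j
    by (simp add: of_int_hop_funpow)
  then have "balanced E R a b" unfolding balanced_def of_int_eq_0_iff by blast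
  moreover have "E = (\<lambda>u v. (u, v) \<in> parcs G)" by (intro ext) (simp add: E_def)
  ultimately show ?thesis by (simp add: R_def V_def)
qed

section \<open>Padding, and the finite case analysis\<close>

text \<open>Isolated vertices bring the number of other vertices up to exactly five.\<close>

lemma balanced_pad:
  assumes "balanced E R a b" "finite R" "finite N"
  shows "balanced (rel_sum E (\<lambda>_ _. False)) (R <+> N) (Inl a) (Inl b)"
proof -
  let ?E = "rel_sum E (\<lambda>_ _. False)"
  \<comment> \<open>Padding vertices have no neighbours, so the iterates are the old ones extended
    by zero.\<close>
  have iter: "(hop ?E (R <+> N) ^^ i) (case_sum f (\<lambda>_. 0)) = case_sum ((hop E R ^^ i) f) (\<lambda>_. 0 :: int)" for i f
  proof (induction i)
    case (Suc i)
    show ?case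
      unfolding funpow.simps comp_apply Suc
    proof
      fix p
      show "hop ?E (R <+> N) (case_sum ((hop E R ^^ i) f) (\<lambda>_. 0)) p = case_sum (hop E R ((hop E R ^^ i) f)) (\<lambda>_. 0) p"
        using assms(2,3) unfolding hop_def sum.Plus[OF assms(2,3)] by (cases p) simp_all
    qed
  qed (auto split: sum.split)
  have s: "(\<lambda>p. of_bool (?E p (Inl a)) - of_bool (?E p (Inl b)) :: int) = case_sum (\<lambda>v. of_bool (E v a) - of_bool (E v b)) (\<lambda>_. 0)"
    by (auto split: sum.split)
  have t: "(\<lambda>p. of_bool (?E p (Inl a)) + of_bool (?E p (Inl b)) :: int) = case_sum (\<lambda>v. of_bool (E v a) + of_bool (E v b)) (\<lambda>_. 0)"
    by (auto split: sum.split)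
  show ?thesis
    using assms(1) unfolding balanced_def by (simp only: s t iter sum.Plus[OF assms(2,3)]) simp
qed

text \<open>
  In the next two lemmas \<open>a\<close> has the private neighbours \<open>x\<close> (and \<open>x'\<close>), \<open>b\<close> has \<open>y\<close> (and \<open>y'\<close>);
  a variable named by two vertices stands for their adjacency, \<open>cp\<close> for \<open>p\<close> being a common neighbour
  of \<open>a\<close> and \<open>b\<close>. The numbers \<open>d\<close> and \<open>g\<close> are the entries of \<open>H u\<close> and \<open>H w\<close>, and the equations
  are the orthogonality relations for \<open>(i, j) = (1, 0), (1, 1), (2, 1), (2, 2)\<close>.
\<close>

lemma one_private_nbr_cases:
  fixes xy xp xq xr yp yq yr pq pr qr cp cq cr :: bool
    and dx dy dp dq dr gx gy gp gq gr :: int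
  assumes d: "dx = - of_bool xy" "dy = of_bool xy"
     "dp = of_bool xp - of_bool yp" "dq = of_bool xq - of_bool yq" "dr = of_bool xr - of_bool yr"
   and g: "gx = of_bool xy + 2 * (of_bool xp * of_bool cp + of_bool xq * of_bool cq + of_bool xr * of_bool cr)"
     "gy = of_bool xy + 2 * (of_bool yp * of_bool cp + of_bool yq * of_bool cq + of_bool yr * of_bool cr)"
     "gp = of_bool xp + of_bool yp + 2 * (of_bool pq * of_bool cq + of_bool pr * of_bool cr)"
     "gq = of_bool xq + of_bool yq + 2 * (of_bool pq * of_bool cp + of_bool qr * of_bool cr)"
     "gr = of_bool xr + of_bool yr + 2 * (of_bool pr * of_bool cp + of_bool qr * of_bool cq)"
   and eq: "dp * of_bool cp + dq * of_bool cq + dr * of_bool cr = 0"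
     "dx * gx + dy * gy + dp * gp + dq * gq + dr * gr = 0"
     "(of_bool xy * dy + of_bool xp * dp + of_bool xq * dq + of_bool xr * dr) * gx +
      (of_bool xy * dx + of_bool yp * dp + of_bool yq * dq + of_bool yr * dr) * gy +
      (of_bool xp * dx + of_bool yp * dy + of_bool pq * dq + of_bool pr * dr) * gp +
      (of_bool xq * dx + of_bool yq * dy + of_bool pq * dp + of_bool qr * dr) * gq +
      (of_bool xr * dx + of_bool yr * dy + of_bool pr * dp + of_bool qr * dq) * gr = 0"
     "(of_bool xy * dy + of_bool xp * dp + of_bool xq * dq + of_bool xr * dr) *
      (of_bool xy * gy + of_bool xp * gp + of_bool xq * gq + of_bool xr * gr) +
      (of_bool xy * dx + of_bool yp * dp + of_bool yq * dq + of_bool yr * dr) *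
      (of_bool xy * gx + of_bool yp * gp + of_bool yq * gq + of_bool yr * gr) +
      (of_bool xp * dx + of_bool yp * dy + of_bool pq * dq + of_bool pr * dr) *
      (of_bool xp * gx + of_bool yp * gy + of_bool pq * gq + of_bool pr * gr) +
      (of_bool xq * dx + of_bool yq * dy + of_bool pq * dp + of_bool qr * dr) *
      (of_bool xq * gx + of_bool yq * gy + of_bool pq * gp + of_bool qr * gr) +
      (of_bool xr * dx + of_bool yr * dy + of_bool pr * dp + of_bool qr * dq) *
      (of_bool xr * gx + of_bool yr * gy + of_bool pr * gp + of_bool qr * gq) = 0"
  shows "xp = yp \<and> xq = yq \<and> xr = yr \<or>
    xp = yq \<and> xq = yp \<and> xr = yr \<and> cp = cq \<and> pr = qr \<or>
    xp = yr \<and> xr = yp \<and> xq = yq \<and> cp = cr \<and> pq = qr \<or>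
    xq = yr \<and> xr = yq \<and> xp = yp \<and> cq = cr \<and> pq = pr"
proof -
  \<comment> \<open>A closed statement over the booleans, decided by evaluation. The first equation
    and the negated first alternative involve only the nine outer variables, so they discard most
    assignments before the four inner ones are enumerated. The final \<open>blast\<close> restores
    the negated alternative as a disjunct.\<close>
  have "\<forall>cp cq cr xp xq xr yp yq yr.
    let dp = of_bool xp - of_bool yp; dq = of_bool xq - of_bool yq; dr = of_bool xr - of_bool yr :: int in
    dp * of_bool cp + dq * of_bool cq + dr * of_bool cr = 0 \<longrightarrow>
    \<not> (xp = yp \<and> xq = yq \<and> xr = yr) \<longrightarrow>
    (\<forall>pq pr qr xy.
      let dx = - of_bool xy; dy = of_bool xy;
        gx = of_bool xy + 2 * (of_bool xp * of_bool cp + of_bool xq * of_bool cq + of_bool xr * of_bool cr);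
        gy = of_bool xy + 2 * (of_bool yp * of_bool cp + of_bool yq * of_bool cq + of_bool yr * of_bool cr);
        gp = of_bool xp + of_bool yp + 2 * (of_bool pq * of_bool cq + of_bool pr * of_bool cr);
        gq = of_bool xq + of_bool yq + 2 * (of_bool pq * of_bool cp + of_bool qr * of_bool cr);
        gr = of_bool xr + of_bool yr + 2 * (of_bool pr * of_bool cp + of_bool qr * of_bool cq) in
      dx * gx + dy * gy + dp * gp + dq * gq + dr * gr = 0 \<longrightarrow>
     (of_bool xy * dy + of_bool xp * dp + of_bool xq * dq + of_bool xr * dr) * gx +
      (of_bool xy * dx + of_bool yp * dp + of_bool yq * dq + of_bool yr * dr) * gy +
      (of_bool xp * dx + of_bool yp * dy + of_bool pq * dq + of_bool pr * dr) * gp +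
      (of_bool xq * dx + of_bool yq * dy + of_bool pq * dp + of_bool qr * dr) * gq +
      (of_bool xr * dx + of_bool yr * dy + of_bool pr * dp + of_bool qr * dq) * gr = 0 \<longrightarrow>
      (of_bool xy * dy + of_bool xp * dp + of_bool xq * dq + of_bool xr * dr) *
      (of_bool xy * gy + of_bool xp * gp + of_bool xq * gq + of_bool xr * gr) +
      (of_bool xy * dx + of_bool yp * dp + of_bool yq * dq + of_bool yr * dr) *
      (of_bool xy * gx + of_bool yp * gp + of_bool yq * gq + of_bool yr * gr) +
      (of_bool xp * dx + of_bool yp * dy + of_bool pq * dq + of_bool pr * dr) *
      (of_bool xp * gx + of_bool yp * gy + of_bool pq * gq + of_bool pr * gr) +
      (of_bool xq * dx + of_bool yq * dy + of_bool pq * dp + of_bool qr * dr) *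
      (of_bool xq * gx + of_bool yq * gy + of_bool pq * gp + of_bool qr * gr) +
      (of_bool xr * dx + of_bool yr * dy + of_bool pr * dp + of_bool qr * dq) *
      (of_bool xr * gx + of_bool yr * gy + of_bool pr * gp + of_bool qr * gq) = 0 \<longrightarrow>
       xp = yq \<and> xq = yp \<and> xr = yr \<and> cp = cq \<and> pr = qr \<or>
    xp = yr \<and> xr = yp \<and> xq = yq \<and> cp = cr \<and> pq = qr \<or>
    xq = yr \<and> xr = yq \<and> xp = yp \<and> cq = cr \<and> pq = pr)"
    by code_simp
  from this[unfolded Let_def, rule_format, OF eq(1)[unfolded d] _ eq(2-4)[unfolded d g]]
  show ?thesis by blast
qed
lemma two_private_nbrs_cases:
  fixes xx yy xy xy' x'y x'y' xz x'z yz y'z c :: bool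
    and dx dx' dy dy' dz gx gx' gy gy' gz :: int
  assumes d: "dx = of_bool xx - of_bool xy - of_bool xy'" "dx' = of_bool xx - of_bool x'y - of_bool x'y'"
     "dy = of_bool xy + of_bool x'y - of_bool yy" "dy' = of_bool xy' + of_bool x'y' - of_bool yy"
     "dz = of_bool xz + of_bool x'z - of_bool yz - of_bool y'z"
   and g: "gx = of_bool xx + of_bool xy + of_bool xy' + 2 * (of_bool xz * of_bool c)"
     "gx' = of_bool xx + of_bool x'y + of_bool x'y' + 2 * (of_bool x'z * of_bool c)"
     "gy = of_bool xy + of_bool x'y + of_bool yy + 2 * (of_bool yz * of_bool c)"
     "gy' = of_bool xy' + of_bool x'y' + of_bool yy + 2 * (of_bool y'z * of_bool c)"
     "gz = of_bool xz + of_bool x'z + of_bool yz + of_bool y'z"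
   and eq: "of_bool xx - of_bool yy + dz * of_bool c = 0"
     "dx * gx + dx' * gx' + dy * gy + dy' * gy' + dz * gz = 0"
     "(of_bool xx * dx' + of_bool xy * dy + of_bool xy' * dy' + of_bool xz * dz) * gx +
      (of_bool xx * dx + of_bool x'y * dy + of_bool x'y' * dy' + of_bool x'z * dz) * gx' +
      (of_bool xy * dx + of_bool x'y * dx' + of_bool yy * dy' + of_bool yz * dz) * gy +
      (of_bool xy' * dx + of_bool x'y' * dx' + of_bool yy * dy + of_bool y'z * dz) * gy' +
      (of_bool xz * dx + of_bool x'z * dx' + of_bool yz * dy + of_bool y'z * dy') * gz = 0"
  shows "xx = yy \<and> (xz = yz \<and> x'z = y'z \<and> xy' = x'y \<or> xz = y'z \<and> x'z = yz \<and> xy = x'y')"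
proof -
  \<comment> \<open>Again the equation in the outer variables comes first and prunes the
    enumeration.\<close>
  have "\<forall>c xz x'z yz y'z xx yy.
    let dz = of_bool xz + of_bool x'z - of_bool yz - of_bool y'z :: int in
    of_bool xx - of_bool yy + dz * of_bool c = 0 \<longrightarrow>
    (\<forall>xy xy' x'y x'y'.
      let dx = of_bool xx - of_bool xy - of_bool xy'; dx' = of_bool xx - of_bool x'y - of_bool x'y';
        dy = of_bool xy + of_bool x'y - of_bool yy; dy' = of_bool xy' + of_bool x'y' - of_bool yy;
        gx = of_bool xx + of_bool xy + of_bool xy' + 2 * (of_bool xz * of_bool c);
        gx' = of_bool xx + of_bool x'y + of_bool x'y' + 2 * (of_bool x'z * of_bool c);
        gy = of_bool xy + of_bool x'y + of_bool yy + 2 * (of_bool yz * of_bool c);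
        gy' = of_bool xy' + of_bool x'y' + of_bool yy + 2 * (of_bool y'z * of_bool c);
        gz = of_bool xz + of_bool x'z + of_bool yz + of_bool y'z in
      dx * gx + dx' * gx' + dy * gy + dy' * gy' + dz * gz = 0 \<longrightarrow>
      (of_bool xx * dx' + of_bool xy * dy + of_bool xy' * dy' + of_bool xz * dz) * gx +
      (of_bool xx * dx + of_bool x'y * dy + of_bool x'y' * dy' + of_bool x'z * dz) * gx' +
      (of_bool xy * dx + of_bool x'y * dx' + of_bool yy * dy' + of_bool yz * dz) * gy +
      (of_bool xy' * dx + of_bool x'y' * dx' + of_bool yy * dy + of_bool y'z * dz) * gy' +
      (of_bool xz * dx + of_bool x'z * dx' + of_bool yz * dy + of_bool y'z * dy') * gz = 0 \<longrightarrow>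
      xx = yy \<and> (xz = yz \<and> x'z = y'z \<and> xy' = x'y \<or> xz = y'z \<and> x'z = yz \<and> xy = x'y'))"
    by code_simp
  from this[unfolded Let_def, rule_format, OF eq(1)[unfolded d] eq(2,3)[unfolded d g]]
  show ?thesis .
qed

section \<open>Reflections exchanging the two vertices\<close>

text \<open>With five other vertices, one, two or no private neighbours on each side are the only
  possibilities, and each gives an explicit product of disjoint transpositions. Being an involution
  makes \<open>f\<close> bijective at once and later allows the padding to be removed.\<close>

lemma balanced_imp_reflection:
  fixes E :: "'a \<Rightarrow> 'a \<Rightarrow> bool"
  assumes sym: "\<And>u v. E u v \<longleftrightarrow> E v u" and irr: "\<And>u. \<not> E u u"
    and R: "card R = 5" and ab: "a \<noteq> b" "a \<notin> R" "b \<notin> R" and bal: "balanced E R a b"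
  shows "\<exists>f. (\<forall>v. f (f v) = v) \<and> f a = b \<and> f ` insert a (insert b R) \<subseteq> insert a (insert b R) \<and>
    (\<forall>u\<in>insert a (insert b R). \<forall>v\<in>insert a (insert b R). E (f u) (f v) \<longleftrightarrow> E u v)"
proof -
  define u :: "'a \<Rightarrow> int" where "u = (\<lambda>v. of_bool (E v a) - of_bool (E v b))"
  define w :: "'a \<Rightarrow> int" where "w = (\<lambda>v. of_bool (E v a) + of_bool (E v b))"
  have bal: "(\<Sum>v\<in>R. (hop E R ^^ i) u v * (hop E R ^^ j) w v) = 0" for i j
    using bal unfolding balanced_def u_def w_def by blast
  have finR: "finite R" using R by (simp add: card_ge_0_finite)
  \<comment> \<open>\<open>X\<close> and \<open>Y\<close> are the private neighbours of
    \<open>a\<close> and \<open>b\<close>. A vertex of \<open>Z\<close> is adjacent to both or to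
    neither.\<close>
  define X where "X = {v \<in> R. E v a \<and> \<not> E v b}"
  define Y where "Y = {v \<in> R. E v b \<and> \<not> E v a}"
  define Z where "Z = R - X - Y"
  have fin: "finite X" "finite Y" "finite Z" using finR by (auto simp: X_def Y_def Z_def)
  have Rsplit: "R = X \<union> Y \<union> Z" and disj: "X \<inter> Y = {}" "X \<inter> Z = {}" "Y \<inter> Z = {}"
    by (auto simp: X_def Y_def Z_def)
  have XE: "E v a" "\<not> E v b" if "v \<in> X" for v using that by (auto simp: X_def)
  have YE: "\<not> E v a" "E v b" if "v \<in> Y" for v using that by (auto simp: Y_def)
  have ZE: "E v b \<longleftrightarrow> E v a" if "v \<in> Z" for v using that by (auto simp: X_def Y_def Z_def)
  \<comment> \<open>The relation for \<open>i = j = 0\<close>: \<open>u v * w v\<close> is 1 on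
    \<open>X\<close>, -1 on \<open>Y\<close> and 0 elsewhere.\<close>
  have "0 = (\<Sum>v\<in>R. u v * w v)" using bal[of 0 0] by simp
  also have "\<dots> = (\<Sum>v\<in>R. of_bool (v \<in> X)) - (\<Sum>v\<in>R. of_bool (v \<in> Y))"
    unfolding sum_subtractf[symmetric]
    by (intro sum.cong refl) (auto simp: u_def w_def X_def Y_def)
  also have "\<dots> = int (card (R \<inter> X)) - int (card (R \<inter> Y))"
    using finR by (simp add: Int_def)
  also have "R \<inter> X = X" by (auto simp: X_def)
  also have "R \<inter> Y = Y" by (auto simp: Y_def)
  finally have XY: "card Y = card X" by simp
  have "card R = card X + card Y + card Z"
    unfolding Rsplit using fin disj by (simp add: card_Un_disjoint Int_Un_distrib2)
  then have cardZ: "2 * card X + card Z = 5" using XY R by simp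
  then have "card X = 0 \<or> card X = 1 \<and> card Z = 3 \<or> card X = 2 \<and> card Z = 1" by arith
  then consider "card X = 0" | "card X = 1" "card Z = 3" | "card X = 2" "card Z = 1" by auto
  then show ?thesis
  proof cases
    case 1
    then have "X = {}" "Y = {}" using XY fin by auto
    then have RE: "E v b \<longleftrightarrow> E v a" if "v \<in> R" for v using ZE Rsplit that by auto
    have Ea: "E a v \<longleftrightarrow> E v a" "E b v \<longleftrightarrow> E v a" if "v \<in> R" for v
      using sym RE that by metis+
    have Eb: "E b a \<longleftrightarrow> E a b" by (rule sym)
    have ne: "v \<noteq> a" "v \<noteq> b" if "v \<in> R" for v
      using that ab by auto
    show ?thesis
      by (intro exI[of _ "id(a := b, b := a)"]) (use ab(1) in \<open>auto simp: RE Ea Eb ne irr\<close>)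
  next
    case 2
    then obtain x y where xy: "X = {x}" "Y = {y}" using XY by (metis card_1_singletonE)
    from 2 obtain p q r where pqr: "Z = {p, q, r}" "p \<noteq> q" "p \<noteq> r" "q \<noteq> r" by (metis card_3_iff)
    have Rxy: "R = {x, y, p, q, r}" using Rsplit xy pqr by auto
    have ne: "x \<noteq> y" "x \<noteq> p" "x \<noteq> q" "x \<noteq> r" "y \<noteq> p" "y \<noteq> q" "y \<noteq> r" 
      using disj xy pqr by auto
    have ne_a: "a \<noteq> x" "a \<noteq> y" "a \<noteq> p" "a \<noteq> q" "a \<noteq> r" "b \<noteq> x" "b \<noteq> y" "b \<noteq> p" "b \<noteq> q" "b \<noteq> r"
      using ab Rxy by auto
    have Ea: "E x a" "\<not> E x b" "\<not> E y a" "E y b" "E p b = E p a" "E q b = E q a" "E r b = E r a"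
      using XE YE ZE xy pqr by auto
    \<comment> \<open>Together with \<open>Es\<close> these rules leave a single atom for each
      unordered pair, and only \<open>E p a\<close> for the adjacency of \<open>p\<close> to
      \<open>a\<close> or \<open>b\<close>, likewise for \<open>q\<close> and \<open>r\<close>. The
      atoms then match the variables of the case lemma.\<close>
    have Eb: "E a x" "\<not> E b x" "\<not> E a y" "E b y" "E a p = E p a" "E a q = E q a" "E a r = E r a"
      "E b p = E p a" "E b q = E q a" "E b r = E r a" "E b a = E a b"
      using Ea sym by metis+
    have Es: "E y x = E x y" "E p x = E x p" "E q x = E x q" "E r x = E x r" "E p y = E y p"
      "E q y = E y q" "E r y = E y r" "E q p = E p q" "E r p = E p r" "E r q = E q r"
      by (rule sym)+
    have sumR: "(\<Sum>v\<in>R. f v) = f x + f y + f p + f q + f r" for f :: "'a \<Rightarrow> int"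
      unfolding Rxy using ne pqr by simp
    have hopR: "hop E R f v = of_bool (E v x) * f x + of_bool (E v y) * f y + of_bool (E v p) * f p + of_bool (E v q) * f q + of_bool (E v r) * f r" for f :: "'a \<Rightarrow> int" and v
      unfolding hop_def by (rule sumR)
    have uv: "u x = 1" "u y = -1" "u p = 0" "u q = 0" "u r = 0" 
      "w x = 1" "w y = 1" "w p = 2 * of_bool (E p a)" "w q = 2 * of_bool (E q a)" "w r = 2 * of_bool (E r a)"
      using Ea by (simp_all add: u_def w_def)
    define d where "d = hop E R u"
    define g where "g = hop E R w"
    have dv: "d x = - of_bool (E x y)" "d y = of_bool (E x y)" "d p = of_bool (E x p) - of_bool (E y p)"
      "d q = of_bool (E x q) - of_bool (E y q)" "d r = of_bool (E x r) - of_bool (E y r)"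
      unfolding d_def hopR uv by (simp_all add: irr Es)
    have gv: "g x = of_bool (E x y) + 2 * (of_bool (E x p) * of_bool (E p a) + of_bool (E x q) * of_bool (E q a) + of_bool (E x r) * of_bool (E r a))"
      "g y = of_bool (E x y) + 2 * (of_bool (E y p) * of_bool (E p a) + of_bool (E y q) * of_bool (E q a) + of_bool (E y r) * of_bool (E r a))"
      "g p = of_bool (E x p) + of_bool (E y p) + 2 * (of_bool (E p q) * of_bool (E q a) + of_bool (E p r) * of_bool (E r a))"
      "g q = of_bool (E x q) + of_bool (E y q) + 2 * (of_bool (E p q) * of_bool (E p a) + of_bool (E q r) * of_bool (E r a))"
      "g r = of_bool (E x r) + of_bool (E y r) + 2 * (of_bool (E p r) * of_bool (E p a) + of_bool (E q r) * of_bool (E q a))"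
      unfolding g_def hopR uv by (simp_all add: irr Es)
    have it: "(hop E R ^^ 0) w = w" "(hop E R ^^ 1) u = d" "(hop E R ^^ 1) w = g" "(hop E R ^^ 2) u = hop E R d" "(hop E R ^^ 2) w = hop E R g"
      by (simp_all add: d_def g_def numeral_2_eq_2)
    \<comment> \<open>The terms \<open>d x\<close> and \<open>d y\<close> cancel, and the common
      factor 2 from the entries of \<open>w\<close> on \<open>Z\<close> is dropped.\<close>
    have e1: "d p * of_bool (E p a) + d q * of_bool (E q a) + d r * of_bool (E r a) = 0"
      using bal[of 1 0, unfolded sumR it uv] dv(1,2) by simp
    have e2: "d x * g x + d y * g y + d p * g p + d q * g q + d r * g r = 0"
      using bal[of 1 1, unfolded sumR it] .
    have e3: "hop E R d x * g x + hop E R d y * g y + hop E R d p * g p + hop E R d q * g q + hop E R d r * g r = 0"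
      using bal[of 2 1, unfolded sumR it] .
    have e4: "hop E R d x * hop E R g x + hop E R d y * hop E R g y + hop E R d p * hop E R g p + hop E R d q * hop E R g q + hop E R d r * hop E R g r = 0"
      using bal[of 2 2, unfolded sumR it] .
    have hops: 
      "hop E R f x = of_bool (E x y) * f y + of_bool (E x p) * f p + of_bool (E x q) * f q + of_bool (E x r) * f r"
      "hop E R f y = of_bool (E x y) * f x + of_bool (E y p) * f p + of_bool (E y q) * f q + of_bool (E y r) * f r"
      "hop E R f p = of_bool (E x p) * f x + of_bool (E y p) * f y + of_bool (E p q) * f q + of_bool (E p r) * f r"
      "hop E R f q = of_bool (E x q) * f x + of_bool (E y q) * f y + of_bool (E p q) * f p + of_bool (E q r) * f r"
      "hop E R f r = of_bool (E x r) * f x + of_bool (E y r) * f y + of_bool (E p r) * f p + of_bool (E q r) * f q" for f :: "'a \<Rightarrow> int"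
      unfolding hopR by (simp_all add: irr Es)
    note facts = ne pqr(2-4) ne_a ab(1) Ea Eb Es irr
    \<comment> \<open>The four alternatives are the invariance conditions for swapping
      \<open>x\<close> with \<open>y\<close> and, in addition, nothing, \<open>p\<close> with
      \<open>q\<close>, \<open>p\<close> with \<open>r\<close>, or \<open>q\<close> with
      \<open>r\<close>.\<close>
    from one_private_nbr_cases[OF dv gv e1 e2 e3[unfolded hops] e4[unfolded hops]]
    show ?thesis
    proof (elim disjE conjE)
      assume "E x p = E y p" "E x q = E y q" "E x r = E y r"
      then show ?thesis unfolding Rxy
        by (intro exI[of _ "id(a := b, b := a, x := y, y := x)"]) (use facts in \<open>simp add: eq_commute\<close>)
    next
      assume "E x p = E y q" "E x q = E y p" "E x r = E y r" "E p a = E q a" "E p r = E q r"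
      then show ?thesis unfolding Rxy
        by (intro exI[of _ "id(a := b, b := a, x := y, y := x, p := q, q := p)"]) (use facts in \<open>simp add: eq_commute\<close>)
    next
      assume "E x p = E y r" "E x r = E y p" "E x q = E y q" "E p a = E r a" "E p q = E q r"
      then show ?thesis unfolding Rxy
        by (intro exI[of _ "id(a := b, b := a, x := y, y := x, p := r, r := p)"]) (use facts in \<open>simp add: eq_commute\<close>)
    next
      assume "E x q = E y r" "E x r = E y q" "E x p = E y p" "E q a = E r a" "E p q = E p r"
      then show ?thesis unfolding Rxy
        by (intro exI[of _ "id(a := b, b := a, x := y, y := x, q := r, r := q)"]) (use facts in \<open>simp add: eq_commute\<close>)
    qed
  next
    case 3
    then obtain x x' y y' z where xy: "X = {x, x'}" "x \<noteq> x'" "Y = {y, y'}" "y \<noteq> y'" "Z = {z}"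
      using XY by (metis card_1_singletonE card_2_iff)
    have Rxy: "R = {x, x', y, y', z}" using Rsplit xy by auto
    have ne: "x \<noteq> x'" "x \<noteq> y" "x \<noteq> y'" "x \<noteq> z" "x' \<noteq> y" "x' \<noteq> y'" "x' \<noteq> z" "y \<noteq> y'" "y \<noteq> z" "y' \<noteq> z"
      using disj xy by auto
    have ne_a: "a \<noteq> x" "a \<noteq> x'" "a \<noteq> y" "a \<noteq> y'" "a \<noteq> z" "b \<noteq> x" "b \<noteq> x'" "b \<noteq> y" "b \<noteq> y'" "b \<noteq> z"
      using ab Rxy by auto
    have Ea: "E x a" "E x' a" "\<not> E x b" "\<not> E x' b" "\<not> E y a" "\<not> E y' a" "E y b" "E y' b" "E z b = E z a"
      using XE YE ZE xy by auto
    have Eb: "E a x" "E a x'" "\<not> E b x" "\<not> E b x'" "\<not> E a y" "\<not> E a y'" "E b y" "E b y'" "E b z = E z a" "E a z = E z a" "E b a = E a b"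
      using Ea sym by metis+
    have Es: "E x' x = E x x'" "E y x = E x y" "E y' x = E x y'" "E y x' = E x' y" "E y' x' = E x' y'"
      "E z x = E x z" "E z x' = E x' z" "E z y = E y z" "E z y' = E y' z" "E y' y = E y y'"
      by (rule sym)+
    have sumR: "(\<Sum>v\<in>R. f v) = f x + f x' + f y + f y' + f z" for f :: "'a \<Rightarrow> int"
      unfolding Rxy using ne by simp
    have hopR: "hop E R f v = of_bool (E v x) * f x + of_bool (E v x') * f x' + of_bool (E v y) * f y + of_bool (E v y') * f y' + of_bool (E v z) * f z" for f :: "'a \<Rightarrow> int" and v
      unfolding hop_def by (rule sumR)
    have uv: "u x = 1" "u x' = 1" "u y = -1" "u y' = -1" "u z = 0"
      "w x = 1" "w x' = 1" "w y = 1" "w y' = 1" "w z = 2 * of_bool (E z a)"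
      using Ea by (simp_all add: u_def w_def)
    define d where "d = hop E R u"
    define g where "g = hop E R w"
    have dv: "d x = of_bool (E x x') - of_bool (E x y) - of_bool (E x y')"
      "d x' = of_bool (E x x') - of_bool (E x' y) - of_bool (E x' y')"
      "d y = of_bool (E x y) + of_bool (E x' y) - of_bool (E y y')"
      "d y' = of_bool (E x y') + of_bool (E x' y') - of_bool (E y y')"
      "d z = of_bool (E x z) + of_bool (E x' z) - of_bool (E y z) - of_bool (E y' z)"
      unfolding d_def hopR uv by (simp_all add: irr Es)
    have gv: "g x = of_bool (E x x') + of_bool (E x y) + of_bool (E x y') + 2 * (of_bool (E x z) * of_bool (E z a))"
      "g x' = of_bool (E x x') + of_bool (E x' y) + of_bool (E x' y') + 2 * (of_bool (E x' z) * of_bool (E z a))"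
      "g y = of_bool (E x y) + of_bool (E x' y) + of_bool (E y y') + 2 * (of_bool (E y z) * of_bool (E z a))"
      "g y' = of_bool (E x y') + of_bool (E x' y') + of_bool (E y y') + 2 * (of_bool (E y' z) * of_bool (E z a))"
      "g z = of_bool (E x z) + of_bool (E x' z) + of_bool (E y z) + of_bool (E y' z)"
      unfolding g_def hopR uv by (simp_all add: irr Es)
    have it: "(hop E R ^^ 0) w = w" "(hop E R ^^ 1) u = d" "(hop E R ^^ 1) w = g" "(hop E R ^^ 2) u = hop E R d" "(hop E R ^^ 2) w = hop E R g"
      by (simp_all add: d_def g_def numeral_2_eq_2)
    \<comment> \<open>In the sum of \<open>d\<close> over the private neighbours the adjacencies
      between \<open>X\<close> and \<open>Y\<close> cancel. What remains is even and is
      halved.\<close>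
    have e1: "of_bool (E x x') - of_bool (E y y') + d z * of_bool (E z a) = 0"
      using bal[of 1 0, unfolded sumR it uv] dv(1-4) by simp
    have e2: "d x * g x + d x' * g x' + d y * g y + d y' * g y' + d z * g z = 0"
      using bal[of 1 1, unfolded sumR it] .
    have e3: "hop E R d x * g x + hop E R d x' * g x' + hop E R d y * g y + hop E R d y' * g y' + hop E R d z * g z = 0"
      using bal[of 2 1, unfolded sumR it] .
    have hops: 
      "hop E R f x = of_bool (E x x') * f x' + of_bool (E x y) * f y + of_bool (E x y') * f y' + of_bool (E x z) * f z"
      "hop E R f x' = of_bool (E x x') * f x + of_bool (E x' y) * f y + of_bool (E x' y') * f y' + of_bool (E x' z) * f z"
      "hop E R f y = of_bool (E x y) * f x + of_bool (E x' y) * f x' + of_bool (E y y') * f y' + of_bool (E y z) * f z"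
      "hop E R f y' = of_bool (E x y') * f x + of_bool (E x' y') * f x' + of_bool (E y y') * f y + of_bool (E y' z) * f z"
      "hop E R f z = of_bool (E x z) * f x + of_bool (E x' z) * f x' + of_bool (E y z) * f y + of_bool (E y' z) * f y'" for f :: "'a \<Rightarrow> int"
      unfolding hopR by (simp_all add: irr Es)
    note facts = ne ne_a ab(1) Ea Eb Es irr
    \<comment> \<open>The two alternatives correspond to the two ways of matching \<open>x\<close>
      and \<open>x'\<close> with \<open>y\<close> and \<open>y'\<close>; \<open>z\<close> is fixed
      in both.\<close>
    from two_private_nbrs_cases[OF dv gv e1 e2 e3[unfolded hops]]
    show ?thesis
    proof (elim disjE conjE)
      assume "E x x' = E y y'" "E x z = E y z" "E x' z = E y' z" "E x y' = E x' y"
      then show ?thesis unfolding Rxy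
        by (intro exI[of _ "id(a := b, b := a, x := y, y := x, x' := y', y' := x')"]) (use facts in \<open>simp add: eq_commute\<close>)
    next
      assume "E x x' = E y y'" "E x z = E y' z" "E x' z = E y z" "E x y = E x' y'"
      then show ?thesis unfolding Rxy
        by (intro exI[of _ "id(a := b, b := a, x := y', y' := x, x' := y, y := x')"]) (use facts in \<open>simp add: eq_commute\<close>)
    qed
  qed
qed

section \<open>The witness on eight vertices\<close>

definition witness_nbrs :: "nat list list" where
  "witness_nbrs = [[2,3,6,7], [4,5,6,7], [0,3,7], [0,2,6], [1,5,6,7], [1,4], [0,1,3,4,7], [0,1,2,4,6]]"

definition witness :: "nat pair_pre_digraph" where
  "witness = \<lparr>pverts = {..<8}, parcs = {(u, v). u < 8 \<and> v \<in> set (witness_nbrs ! u)}\<rparr>"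

text \<open>Row \<open>j\<close> is an unnormalised eigenvector for
  \<open>witness_eigenvalue j\<close>. For repeated eigenvalues the rows are chosen orthogonal, and
  every row has entries of equal absolute value at 0 and 1.\<close>

definition witness_vec :: "nat \<Rightarrow> nat \<Rightarrow> int" where
  "witness_vec j v =
     [[ 1, 1,  0,  0,  1, -1, -1, -1],
      [ 0, 0, -1,  1,  0,  0, -1,  1],
      [-2, 2,  1,  1, -1, -1,  0,  0],
      [ 2, 2, -1, -1, -3,  1,  0,  0],
      [ 0, 0,  1,  1,  0,  2, -1, -1],
      [ 0, 0,  1, -1,  0,  0, -1,  1],
      [-1, 1, -1, -1,  1,  1,  0,  0],
      [ 4, 4,  3,  3,  4,  2,  5,  5]] ! j ! v"

definition witness_eigenvalue :: "nat \<Rightarrow> int" where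
  "witness_eigenvalue j = [-2, -2, -1, -1, 0, 0, 2, 4] ! j"

lemma witness_simps:
  "pverts witness = {..<8}"
  "(u, v) \<in> parcs witness \<longleftrightarrow> u < 8 \<and> v \<in> set (witness_nbrs ! u)"
  by (simp_all add: witness_def)

lemma witness_nbrs_less: "u < 8 \<Longrightarrow> v \<in> set (witness_nbrs ! u) \<Longrightarrow> v < 8"
proof -
  have "\<forall>u\<in>{..<8}. \<forall>v\<in>set (witness_nbrs ! u). v < 8" by code_simp
  then show "u < 8 \<Longrightarrow> v \<in> set (witness_nbrs ! u) \<Longrightarrow> v < 8" by auto
qed

lemma witness_nbrs_sym:
  assumes "u < 8" "v \<in> set (witness_nbrs ! u)" shows "u \<in> set (witness_nbrs ! v)"
proof -
  have "\<forall>u\<in>{..<8}. \<forall>v\<in>set (witness_nbrs ! u). u \<in> set (witness_nbrs ! v)" by code_simp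
  with assms show ?thesis by auto
qed

lemma witness_nbrs_irrefl: "u < 8 \<Longrightarrow> u \<notin> set (witness_nbrs ! u)"
proof -
  have "\<forall>u\<in>{..<8}. u \<notin> set (witness_nbrs ! u)" by code_simp
  then show "u < 8 \<Longrightarrow> u \<notin> set (witness_nbrs ! u)" by auto
qed

lemma pair_graph_witness: "pair_graph witness"
proof -
  have fin: "finite (parcs witness)"
    by (rule finite_subset[of _ "{..<8} \<times> {..<8}"]) (auto simp: witness_simps witness_nbrs_less)
  show ?thesis
    unfolding pair_graph_def pair_digraph_def pair_pseudo_graph_def pair_fin_digraph_def
      pair_loopfree_digraph_def pair_sym_digraph_def pair_wf_digraph_def
      pair_fin_digraph_axioms_def pair_sym_digraph_axioms_def pair_loopfree_digraph_axioms_def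
      symmetric_def
    using fin by (auto simp: witness_simps witness_nbrs_less witness_nbrs_irrefl
        intro!: symI witness_nbrs_sym)
qed

lemma connected_witness: "Digraph_Component.connected (with_proj witness)"
proof -
  interpret pair_graph witness by (rule pair_graph_witness)
  have arc: "u \<rightarrow>\<^sup>*\<^bsub>with_proj witness\<^esub> v" if "u < 8" "v \<in> set (witness_nbrs ! u)" for u v
    using that by (intro reachable_adjI) (simp add: witness_simps)
  have from0: "0 \<rightarrow>\<^sup>*\<^bsub>with_proj witness\<^esub> v" if v: "v < 8" for v
  proof -
    \<comment> \<open>Vertex 5 is at distance three from 0, so paths of up to three edges are
      examined.\<close>
    have "\<forall>v\<in>{..<8}. v = 0 \<or> (\<exists>w\<in>set (witness_nbrs ! 0). w < 8 \<and> (w = v \<or> (\<exists>x\<in>set (witness_nbrs ! w). x < 8 \<and> (x = v \<or> v \<in> set (witness_nbrs ! x)))))"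
      by code_simp
    with v have "v = 0 \<or> (\<exists>w\<in>set (witness_nbrs ! 0). w < 8 \<and> (w = v \<or> (\<exists>x\<in>set (witness_nbrs ! w). x < 8 \<and> (x = v \<or> v \<in> set (witness_nbrs ! x)))))"
      by blast
    then show ?thesis
      by (elim disjE bexE conjE)
        (simp add: witness_simps, simp add: arc, meson arc reachable_trans zero_less_numeral,
         meson arc reachable_trans zero_less_numeral)
  qed
  show ?thesis unfolding connected_def
  proof (rule strongly_connectedI)
    fix u v assume "u \<in> verts (with_proj (mk_symmetric witness))" "v \<in> verts (with_proj (mk_symmetric witness))"
    then have "0 \<rightarrow>\<^sup>*\<^bsub>with_proj witness\<^esub> u" "0 \<rightarrow>\<^sup>*\<^bsub>with_proj witness\<^esub> v"
      by (simp_all add: from0 witness_simps)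
    then have "u \<rightarrow>\<^sup>*\<^bsub>with_proj witness\<^esub> v"
      using symmetric_reachable[OF sym_arcs] reachable_trans by blast
    then show "u \<rightarrow>\<^sup>*\<^bsub>with_proj (mk_symmetric witness)\<^esub> v" by (rule reachable_mk_symmetricI)
  qed (simp add: witness_simps lessThan_nat_numeral)
qed

text \<open>The squares at 0 and 1 agree for each basis vector separately, hence also after summing
  over an eigenspace.\<close>

lemma cospectral_witness: "cospectral witness 0 1"
proof -
  define N where "N j = (\<Sum>v\<in>{..<8}. witness_vec j v * witness_vec j v)" for j
  define \<phi> where "\<phi> j v = real_of_int (witness_vec j v) / sqrt (real_of_int (N j))" for j v
  \<comment> \<open>Square roots enter only through the normalisation \<open>N\<close>; all
    remaining conditions are integer identities settled by evaluation.\<close>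
  have chk: "\<forall>j\<in>{..<8}. 0 < (\<Sum>v\<in>{..<8}. witness_vec j v * witness_vec j v) \<and>
      witness_vec j 0 * witness_vec j 0 = witness_vec j 1 * witness_vec j 1 \<and>
      (\<forall>i\<in>{..<8}. i \<noteq> j \<longrightarrow> (\<Sum>v\<in>{..<8}. witness_vec i v * witness_vec j v) = 0) \<and>
      (\<forall>u\<in>{..<8}. (\<Sum>v\<in>{..<8}. if v \<in> set (witness_nbrs ! u) then witness_vec j v else 0)
         = witness_eigenvalue j * witness_vec j u)"
    by code_simp
  have "orthonormal_eigenbasis witness \<phi> (\<lambda>j. real_of_int (witness_eigenvalue j))"
    unfolding orthonormal_eigenbasis_def witness_simps card_lessThan
  proof (intro conjI allI impI ballI)
    fix i j :: nat assume ij: "i < 8" "j < 8"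
    have "(\<Sum>v<8. \<phi> i v * \<phi> j v) = real_of_int (\<Sum>v<8. witness_vec i v * witness_vec j v) / (sqrt (real_of_int (N i)) * sqrt (real_of_int (N j)))"
      by (simp add: \<phi>_def sum_divide_distrib)
    also have "\<dots> = (if i = j then 1 else 0)"
    proof (cases "i = j")
      case True
      have "0 < N i" using chk ij by (simp add: N_def)
      then show ?thesis unfolding True N_def[symmetric] by simp
    next
      case False
      then have "(\<Sum>v<8. witness_vec i v * witness_vec j v) = 0" using chk ij by simp
      then show ?thesis using False by (simp only: of_int_0) simp
    qed
    finally show "(\<Sum>v<8. \<phi> i v * \<phi> j v) = (if i = j then 1 else 0)" .
  next
    fix j u :: nat assume ju: "j < 8" "u \<in> {..<8}"
    have "(\<Sum>v<8. adj_matrix witness u v * \<phi> j v) = real_of_int (\<Sum>v<8. if v \<in> set (witness_nbrs ! u) then witness_vec j v else 0) / sqrt (real_of_int (N j))"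
      unfolding of_int_sum sum_divide_distrib
      using ju by (intro sum.cong) (auto simp: \<phi>_def adj_matrix_def witness_simps)
    also have "\<dots> = real_of_int (witness_eigenvalue j) * \<phi> j u"
      using chk ju by (simp add: \<phi>_def)
    finally show "(\<Sum>v<8. adj_matrix witness u v * \<phi> j v) = real_of_int (witness_eigenvalue j) * \<phi> j u" .
  qed
  moreover have "\<bar>\<phi> j 0\<bar>\<^sup>2 = \<bar>\<phi> j 1\<bar>\<^sup>2" if "j < 8" for j
  proof -
    have "real_of_int (witness_vec j 0 * witness_vec j 0) = real_of_int (witness_vec j 1 * witness_vec j 1)"
      using chk that by simp
    then show ?thesis by (simp add: \<phi>_def power_divide power2_eq_square)
  qed
  ultimately show ?thesis
    unfolding cospectral_def eigenspace_weight_def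
    by (intro exI[of _ \<phi>] exI[of _ "\<lambda>j. real_of_int (witness_eigenvalue j)"] conjI ballI sum.cong)
      (auto simp: witness_simps)
qed

text \<open>Vertex 5 is a neighbour of 1 of degree 2. An automorphism taking 0 to 1 would send some
  neighbour of 0 to it, but every neighbour of 0 has degree at least 3.\<close>

lemma not_similar_witness: "\<not> similar_vertices witness 0 1"
proof
  assume "similar_vertices witness 0 1"
  then obtain f where f: "bij_betw f {..<8} {..<8}" and f0: "f 0 = 1"
    and E: "\<And>u v. u < 8 \<Longrightarrow> v < 8 \<Longrightarrow> f v \<in> set (witness_nbrs ! f u) \<longleftrightarrow> v \<in> set (witness_nbrs ! u)"
    unfolding similar_vertices_def graph_automorphism_def witness_simps
    by (metis bij_betwE lessThan_iff)
  have "5 \<in> f ` {..<8}" using f by (simp add: bij_betw_def)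
  then obtain v where v: "v < 8" "f v = 5" by auto
  have "f v \<in> set (witness_nbrs ! f 0)" unfolding f0 v by code_simp
  then have v0: "v \<in> set (witness_nbrs ! 0)" using E[of 0 v] v by simp
  have "f ` set (witness_nbrs ! v) \<subseteq> set (witness_nbrs ! 5)"
    using E[of v] v witness_nbrs_less by fastforce
  moreover have "inj_on f (set (witness_nbrs ! v))"
    by (rule inj_on_subset[OF bij_betw_imp_inj_on[OF f]]) (use v witness_nbrs_less in auto)
  ultimately have "card (set (witness_nbrs ! v)) \<le> card (set (witness_nbrs ! 5))"
    by (metis card_image card_mono finite_set)
  moreover have "\<forall>v\<in>set (witness_nbrs ! 0). \<not> card (set (witness_nbrs ! v)) \<le> card (set (witness_nbrs ! 5))"
    by code_simp
  ultimately show False using v0 by blast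
qed

section \<open>Graphs with fewer than eight vertices\<close>

text \<open>The reflection is obtained on the padded graph and then corrected where it leaves
  \<open>G\<close>.\<close>

lemma cospectral_imp_similar:
  assumes G: "pair_graph G" and card: "card (pverts G) < 8" and a: "a \<in> pverts G" and b: "b \<in> pverts G"
    and cosp: "cospectral G a b"
  shows "similar_vertices G a b"
proof (cases "a = b")
  case True
  have "graph_automorphism G id" by (simp add: graph_automorphism_def)
  with True show ?thesis unfolding similar_vertices_def by (intro exI[of _ id]) simp
next
  case False
  interpret pair_graph G by fact
  let ?V = "pverts G"
  define R where "R = ?V - {a, b}"
  define E where "E = (\<lambda>u v. (u, v) \<in> parcs G)"
  \<comment> \<open>At most five vertices lie outside \<open>{a, b}\<close>, so the truncated
    subtraction is exact.\<close>
  define N where "N = {..<5 - card R}"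
  let ?E = "rel_sum E (\<lambda>_ _. False) :: 'a + nat \<Rightarrow> 'a + nat \<Rightarrow> bool"
  have finR: "finite R" by (simp add: R_def)
  have "card R = card ?V - 2" using a b False by (simp add: R_def card_Diff_subset)
  then have card5: "card (R <+> N) = 5" using card finR by (simp add: N_def card_Plus)
  have symE: "E u v \<longleftrightarrow> E v u" for u v
    using sym_arcs unfolding E_def symmetric_def by (auto dest: symD)
  have irrE: "\<not> E u u" for u
    using no_loops[of "(u, u)"] unfolding E_def by auto
  have notin: "Inl a \<notin> R <+> N" "Inl b \<notin> R <+> N" by (auto simp: R_def)
  have V_eq: "insert (Inl a) (insert (Inl b) (R <+> N)) = ?V <+> N"
    using a b by (auto simp: R_def)
  have symP: "?E p q \<longleftrightarrow> ?E q p" for p q using symE by (cases p; cases q) simp_all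
  have irrP: "\<not> ?E p p" for p using irrE by (cases p) simp_all
  have bal: "balanced ?E (R <+> N) (Inl a) (Inl b)"
    using cospectral_imp_balanced[OF G a b False cosp] finR
    unfolding R_def[symmetric] E_def[symmetric] by (rule balanced_pad) (simp add: N_def)
  have neq: "Inl a \<noteq> (Inl b :: 'a + nat)" using False by simp
  note balanced_imp_reflection[OF symP irrP card5 neq notin bal, unfolded V_eq]
  then obtain f where ff: "\<And>p. f (f p) = p" and fab: "f (Inl a) = Inl b"
    and fV: "f ` (?V <+> N) \<subseteq> ?V <+> N"
    and fE: "\<And>p q. p \<in> ?V <+> N \<Longrightarrow> q \<in> ?V <+> N \<Longrightarrow> ?E (f p) (f q) \<longleftrightarrow> ?E p q"
    by blast
  \<comment> \<open>A vertex that \<open>f\<close> sends to a padding vertex is isolated, so it may as well be fixed.\<close>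
  define g where "g v = (case f (Inl v) of Inl w \<Rightarrow> w | Inr _ \<Rightarrow> v)" for v
  have gg: "g (g v) = v" for v
    using ff[of "Inl v"] by (cases "f (Inl v)") (auto simp: g_def)
  have gV: "g v \<in> ?V" if "v \<in> ?V" for v
  proof (cases "f (Inl v)")
    case (Inl w)
    moreover have "f (Inl v) \<in> ?V <+> N" using fV that by blast
    ultimately show ?thesis by (auto simp: g_def)
  qed (use that in \<open>simp add: g_def\<close>)
  have isolated: "\<not> E u v" if "f (Inl u) = Inr k" "u \<in> ?V" "v \<in> ?V" for u v k
  proof -
    have "?E (f (Inl u)) (f (Inl v)) \<longleftrightarrow> E u v" using that fE[of "Inl u" "Inl v"] by auto
    moreover have "\<not> ?E (Inr k) (f (Inl v))" by (cases "f (Inl v)") auto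
    ultimately show ?thesis using that(1) by simp
  qed
  \<comment> \<open>If an endpoint is sent to a padding vertex, it is isolated and fixed by
    \<open>g\<close>, so both sides are false; otherwise \<open>g\<close> agrees with
    \<open>f\<close> at both endpoints.\<close>
  have gE: "E (g u) (g v) \<longleftrightarrow> E u v" if uv: "u \<in> ?V" "v \<in> ?V" for u v
  proof (cases "f (Inl u)")
    case u: (Inr k)
    then have "g u = u" by (simp add: g_def)
    then show ?thesis using isolated[OF u] uv gV by auto
  next
    case u: (Inl u')
    show ?thesis
    proof (cases "f (Inl v)")
      case v: (Inr k)
      then have "g v = v" by (simp add: g_def)
      then show ?thesis using isolated[OF v] uv gV symE by metis
    next
      case v: (Inl v')
      show ?thesis using fE[of "Inl u" "Inl v"] uv u v by (auto simp: g_def)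
    qed
  qed
  have "bij_betw g ?V ?V"
    by (rule bij_betw_byWitness[where f' = g]) (use gg gV in auto)
  with gE have "graph_automorphism G g"
    by (simp add: graph_automorphism_def E_def)
  moreover have "g a = b" by (simp add: g_def fab)
  ultimately show ?thesis unfolding similar_vertices_def by blast
qed

theorem theorem1p2:
  shows "(\<exists>G :: nat pair_pre_digraph.
            pair_graph G \<and> Digraph_Component.connected (with_proj G) \<and> card (pverts G) = 8 \<and>
            (\<exists>a\<in>pverts G. \<exists>b\<in>pverts G. cospectral G a b \<and> \<not> similar_vertices G a b)) \<and>
         \<not> (\<exists>G :: 'a pair_pre_digraph.
            pair_graph G \<and> Digraph_Component.connected (with_proj G) \<and> card (pverts G) < 8 \<and>
            (\<exists>a\<in>pverts G. \<exists>b\<in>pverts G. cospectral G a b \<and> \<not> similar_vertices G a b))"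
proof
  have "\<exists>a\<in>pverts witness. \<exists>b\<in>pverts witness. cospectral witness a b \<and> \<not> similar_vertices witness a b"
    using cospectral_witness not_similar_witness
    by (rule_tac bexI[of _ 0], rule_tac bexI[of _ 1]) (simp_all add: witness_simps)
  then show "\<exists>G :: nat pair_pre_digraph.
      pair_graph G \<and> Digraph_Component.connected (with_proj G) \<and> card (pverts G) = 8 \<and>
      (\<exists>a\<in>pverts G. \<exists>b\<in>pverts G. cospectral G a b \<and> \<not> similar_vertices G a b)"
    by (intro exI[of _ witness] conjI pair_graph_witness connected_witness)
      (simp add: witness_simps)
next
  show "\<not> (\<exists>G :: 'a pair_pre_digraph.
      pair_graph G \<and> Digraph_Component.connected (with_proj G) \<and> card (pverts G) < 8 \<and>
      (\<exists>a\<in>pverts G. \<exists>b\<in>pverts G. cospectral G a b \<and> \<not> similar_vertices G a b))"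
    by (meson cospectral_imp_similar)
qed

end
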